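(* Let $f$ be as in the context. The sequences $\{x_k\}_{k=0}^\infty$, $\{\phi_k(x)\}_{k=0}^\infty$ and $\{\alpha_k\}_{k=0}^\infty$ generated by the algorithm SUESA (described in the context), from any initial point $x_0\in\mathbb{R}^n$, form an Underestimate Sequence (UES) of $f$.
   Context: Setting (smooth case): $f:\mathbb{R}^n\to\mathbb{R}$ is continuously differentiable, $\mu$-strongly convex and $L$-smooth with $L>\mu>0$, i.e. for all $x,y\in\mathbb{R}^n$ (Euclidean norm): $f(x)\ge f(y)+\langle\nabla f(y),x-y\rangle+\frac{\mu}{2}\|x-y\|^2$ and $f(x)\le f(y)+\langle\nabla f(y),x-y\rangle+\frac{L}{2}\|x-y\|^2$. For a point $y$: $y^{++}:=y-\frac1\mu\nabla f(y)$. For $x,y\in\mathbb{R}^n$ put $\phi(x;y):=f(y)-\frac{1}{2\mu}\|\nabla f(y)\|^2+\frac{\mu}{2}\|x-y^{++}\|^2$. Algorithm SUESA (run without its stopping test, so that infinite sequences are produced): given $x_0$, set $\alpha_k=\mu/L$ for all $k\ge0$ and $\phi_0(x):=\phi(x;x_0)$. For $k=0,1,2,\dots$: set $y_k=x_k$; $x_{k+1}=x_k-\frac1L\nabla f(x_k)$; $\phi_{k+1}(x):=(1-\alpha_k)\phi_k(x)+\alpha_k\phi(x;y_k)$. Definition (UES). A series of sequences $\{x_k\}_{k=0}^\infty\subset\mathbb{R}^n$, $\{\phi_k(x)\}_{k=0}^\infty$ (real-valued functions on $\mathbb{R}^n$, each attaining its minimum) and $\{\alpha_k\}_{k=0}^\infty$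 with $\alpha_k\in(0,1)$ for all $k\ge0$ is called an Underestimate Sequence (UES) of a function $F:\mathbb{R}^n\to\mathbb{R}$ if for all $x\in\mathbb{R}^n$ and all $k\ge0$: (i) $\phi_k(x)\le F(x)$; and (ii) $F(x_{k+1})-\phi_{k+1}^*\le(1-\alpha_k)(F(x_k)-\phi_k^* )$, where $\phi_k^*:=\min_x\phi_k(x)$. Here $F=f$. *)

theory Defs
  imports "HOL-Analysis.Analysis"
begin

definition gradient :: "(real ^ 'n \<Rightarrow> real) \<Rightarrow> real ^ 'n \<Rightarrow> real ^ 'n"
  where "gradient f x = (THE D. GDERIV f x :> D)"

definition continuously_differentiable :: "(real ^ 'n \<Rightarrow> real) \<Rightarrow> bool"
  where "continuously_differentiable f \<longleftrightarrow>
    f differentiable_on UNIV \<and> continuous_on UNIV (gradient f)"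

definition strongly_convex :: "real \<Rightarrow> (real ^ 'n \<Rightarrow> real) \<Rightarrow> bool"
  where "strongly_convex \<mu> f \<longleftrightarrow>
    (\<forall>x y. f x \<ge> f y + gradient f y \<bullet> (x - y) + \<mu> / 2 * (norm (x - y))\<^sup>2)"

definition smooth_with :: "real \<Rightarrow> (real ^ 'n \<Rightarrow> real) \<Rightarrow> bool"
  where "smooth_with L f \<longleftrightarrow>
    (\<forall>x y. f x \<le> f y + gradient f y \<bullet> (x - y) + L / 2 * (norm (x - y))\<^sup>2)"

text \<open>The long gradient step \<open>y\<^sup>+\<^sup>+\<close>.\<close>

definition long_step :: "real \<Rightarrow> (real ^ 'n \<Rightarrow> real) \<Rightarrow> real ^ 'n \<Rightarrow> real ^ 'n"
  where "long_step \<mu> f y = y - (1 / \<mu>) *\<^sub>R gradient f y"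

text \<open>The quadratic \<open>\<phi>(x; y)\<close>; the base point \<open>y\<close> comes first so that
  \<open>quad_model \<mu> f y\<close> is a function of \<open>x\<close>.\<close>

definition quad_model :: "real \<Rightarrow> (real ^ 'n \<Rightarrow> real) \<Rightarrow> real ^ 'n \<Rightarrow> real ^ 'n \<Rightarrow> real"
  where "quad_model \<mu> f y x =
    f y - 1 / (2 * \<mu>) * (norm (gradient f y))\<^sup>2 + \<mu> / 2 * (norm (x - long_step \<mu> f y))\<^sup>2"

definition suesa_alpha :: "real \<Rightarrow> real \<Rightarrow> nat \<Rightarrow> real"
  where "suesa_alpha \<mu> L k = \<mu> / L"

primrec suesa_x :: "real \<Rightarrow> (real ^ 'n \<Rightarrow> real) \<Rightarrow> real ^ 'n \<Rightarrow> nat \<Rightarrow> real ^ 'n"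
  where
    "suesa_x L f x0 0 = x0"
  | "suesa_x L f x0 (Suc k) =
      suesa_x L f x0 k - (1 / L) *\<^sub>R gradient f (suesa_x L f x0 k)"

definition suesa_y :: "real \<Rightarrow> (real ^ 'n \<Rightarrow> real) \<Rightarrow> real ^ 'n \<Rightarrow> nat \<Rightarrow> real ^ 'n"
  where "suesa_y L f x0 k = suesa_x L f x0 k"

primrec suesa_phi ::
  "real \<Rightarrow> real \<Rightarrow> (real ^ 'n \<Rightarrow> real) \<Rightarrow> real ^ 'n \<Rightarrow> nat \<Rightarrow> real ^ 'n \<Rightarrow> real"
  where
    "suesa_phi \<mu> L f x0 0 = quad_model \<mu> f x0"
  | "suesa_phi \<mu> L f x0 (Suc k) = (\<lambda>x.
      (1 - suesa_alpha \<mu> L k) * suesa_phi \<mu> L f x0 k x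
        + suesa_alpha \<mu> L k * quad_model \<mu> f (suesa_y L f x0 k) x)"

definition attains_min :: "(real ^ 'n \<Rightarrow> real) \<Rightarrow> bool"
  where "attains_min g \<longleftrightarrow> (\<exists>z. \<forall>x. g z \<le> g x)"

text \<open>Only meaningful under \<^const>\<open>attains_min\<close>.\<close>

definition min_value :: "(real ^ 'n \<Rightarrow> real) \<Rightarrow> real"
  where "min_value g = (LEAST v. v \<in> range g)"

definition underestimate_sequence ::
  "(real ^ 'n \<Rightarrow> real) \<Rightarrow> (nat \<Rightarrow> real ^ 'n) \<Rightarrow> (nat \<Rightarrow> real ^ 'n \<Rightarrow> real) \<Rightarrow> (nat \<Rightarrow> real) \<Rightarrow> bool"
  where "underestimate_sequence F x \<phi> \<alpha> \<longleftrightarrow>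
    (\<forall>k. attains_min (\<phi> k)) \<and>
    (\<forall>k. 0 < \<alpha> k \<and> \<alpha> k < 1) \<and>
    (\<forall>k z. \<phi> k z \<le> F z) \<and>
    (\<forall>k. F (x (Suc k)) - min_value (\<phi> (Suc k)) \<le> (1 - \<alpha> k) * (F (x k) - min_value (\<phi> k)))"

end

theory Submission
  imports Defs
begin

text \<open>
  The model \<open>quad_model \<mu> f y\<close> is the strong convexity lower bound of \<open>f\<close> at \<open>y\<close> with the square
  completed, so it lies below \<open>f\<close> (\<open>quad_model_le\<close>), and so does every convex combination of such
  models.  All models have the same curvature \<open>\<mu>\<close>; hence their convex combinations are again
  parabolas of curvature \<open>\<mu>\<close> and attain their minimum (\<open>parabola_convex_comb\<close>).

  The contraction holds because a gain in \<open>f\<close> balances a loss in the models.  By smoothness the step of length \<open>1 / L\<close> gains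
  \<open>f x' \<le> f x - \<parallel>\<nabla>f x\<parallel>\<^sup>2 / (2 * L)\<close>.  A minimum of a convex combination is at least the convex
  combination of the minima, and the minimum of the model at \<open>x\<close> is \<open>f x - \<parallel>\<nabla>f x\<parallel>\<^sup>2 / (2 * \<mu>)\<close>,
  so averaging with weight \<open>\<alpha>\<close> costs at most \<open>\<alpha> * \<parallel>\<nabla>f x\<parallel>\<^sup>2 / (2 * \<mu>)\<close>.  The choice
  \<open>\<alpha> = \<mu> / L\<close> is exactly the one that makes the gain pay for the cost.
\<close>

lemma quad_model_eq_first_order:
  assumes "\<mu> \<noteq> 0"
  shows "quad_model \<mu> f y x = f y + gradient f y \<bullet> (x - y) + \<mu> / 2 * (norm (x - y))\<^sup>2"
proof -
  have "x - long_step \<mu> f y = (x - y) + (1 / \<mu>) *\<^sub>R gradient f y"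
    by (simp add: long_step_def)
  have "(norm (x - long_step \<mu> f y))\<^sup>2
      = (norm (x - y))\<^sup>2 + 2 / \<mu> * (gradient f y \<bullet> (x - y)) + (norm (gradient f y))\<^sup>2 / \<mu>\<^sup>2"
    unfolding \<open>x - long_step \<mu> f y = _\<close> power2_norm_eq_inner inner_add_left inner_add_right
    by (simp add: inner_commute power2_eq_square)
  then show ?thesis
    using assms by (simp add: quad_model_def distrib_left power2_eq_square)
qed

lemma quad_model_le:
  assumes "\<mu> \<noteq> 0" and "strongly_convex \<mu> f"
  shows "quad_model \<mu> f y x \<le> f x"
  using assms by (simp add: quad_model_eq_first_order strongly_convex_def)

lemma quad_model_ge:
  assumes "0 \<le> \<mu>"
  shows "f y - (norm (gradient f y))\<^sup>2 / (2 * \<mu>) \<le> quad_model \<mu> f y x"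
  using assms by (simp add: quad_model_def)

definition is_parabola :: "real \<Rightarrow> (real ^ 'n \<Rightarrow> real) \<Rightarrow> bool"
  where "is_parabola \<mu> g \<longleftrightarrow> (\<exists>c v. \<forall>x. g x = c + \<mu> / 2 * (norm (x - v))\<^sup>2)"

lemma is_parabola_quad_model: "is_parabola \<mu> (quad_model \<mu> f y)"
  unfolding is_parabola_def quad_model_def by blast

lemma norm_sq_convex_comb:
  fixes x v w :: "'a :: real_inner"
  shows "(1 - a) * (norm (x - v))\<^sup>2 + a * (norm (x - w))\<^sup>2
    = (norm (x - ((1 - a) *\<^sub>R v + a *\<^sub>R w)))\<^sup>2 + a * (1 - a) * (norm (v - w))\<^sup>2"
  unfolding power2_norm_eq_inner
  by (simp add: inner_add_left inner_add_right inner_diff_left inner_diff_right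
      inner_commute algebra_simps power2_eq_square)

text \<open>Averaging keeps the curvature, moves the vertex to the average of the two vertices, and adds a
  constant that grows with their distance.\<close>

lemma parabola_convex_comb:
  assumes "is_parabola \<mu> g" and "is_parabola \<mu> h"
  shows "is_parabola \<mu> (\<lambda>x. (1 - a) * g x + a * h x)"
proof -
  obtain c v d w where g: "\<And>x. g x = c + \<mu> / 2 * (norm (x - v))\<^sup>2"
    and h: "\<And>x. h x = d + \<mu> / 2 * (norm (x - w))\<^sup>2"
    using assms unfolding is_parabola_def by blast
  have "(1 - a) * g x + a * h x
      = ((1 - a) * c + a * d + \<mu> / 2 * (a * (1 - a) * (norm (v - w))\<^sup>2))
        + \<mu> / 2 * (norm (x - ((1 - a) *\<^sub>R v + a *\<^sub>R w)))\<^sup>2" for x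
  proof -
    have "(1 - a) * g x + a * h x
      = (1 - a) * c + a * d + \<mu> / 2 * ((1 - a) * (norm (x - v))\<^sup>2 + a * (norm (x - w))\<^sup>2)"
      unfolding g h by (simp add: distrib_left mult.left_commute)
    then show ?thesis
      unfolding norm_sq_convex_comb by (simp add: distrib_left)
  qed
  then show ?thesis
    unfolding is_parabola_def by blast
qed

lemma is_parabola_suesa_phi: "is_parabola \<mu> (suesa_phi \<mu> L f x0 k)"
  by (induction k) (simp_all add: is_parabola_quad_model parabola_convex_comb)

lemma attains_min_parabola:
  assumes "is_parabola \<mu> g" and "0 \<le> \<mu>"
  shows "attains_min g"
proof -
  obtain c v where g: "\<And>x. g x = c + \<mu> / 2 * (norm (x - v))\<^sup>2"
    using assms(1) unfolding is_parabola_def by blast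
  have "g v \<le> g x" for x
    using assms(2) by (simp add: g)
  then show ?thesis
    unfolding attains_min_def by blast
qed

lemma min_value_attained:
  assumes "attains_min g"
  obtains z where "min_value g = g z" and "\<And>x. g z \<le> g x"
proof -
  obtain z where z: "\<And>x. g z \<le> g x"
    using assms unfolding attains_min_def by blast
  have "min_value g = g z"
    unfolding min_value_def by (rule Least_equality) (use z in auto)
  with z that show thesis
    by blast
qed

lemma min_value_convex_comb_ge:
  assumes "attains_min g" and "attains_min (\<lambda>x. (1 - a) * g x + a * h x)"
    and "0 \<le> a" and "a \<le> 1" and "\<And>x. b \<le> h x"
  shows "(1 - a) * min_value g + a * b \<le> min_value (\<lambda>x. (1 - a) * g x + a * h x)"
proof -
  obtain z where z: "min_value (\<lambda>x. (1 - a) * g x + a * h x) = (1 - a) * g z + a * h z"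
    using assms(2) by (rule min_value_attained)
  have "min_value g \<le> g z"
    using assms(1) by (metis min_value_attained)
  then show ?thesis
    unfolding z using assms(3-5) by (intro add_mono mult_left_mono) auto
qed

text \<open>The step length \<open>1 / L\<close> minimizes the smoothness upper bound along the negative gradient.\<close>

lemma gradient_step_decrease:
  assumes "smooth_with L f" and "L \<noteq> 0"
  shows "f (y - (1 / L) *\<^sub>R gradient f y) \<le> f y - (norm (gradient f y))\<^sup>2 / (2 * L)"
proof -
  let ?g = "gradient f y"
  have "f (y - (1 / L) *\<^sub>R ?g)
      \<le> f y + ?g \<bullet> ((y - (1 / L) *\<^sub>R ?g) - y) + L / 2 * (norm ((y - (1 / L) *\<^sub>R ?g) - y))\<^sup>2"
    using assms(1) unfolding smooth_with_def by blast
  also have "\<dots> = f y - (norm ?g)\<^sup>2 / (2 * L)"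
    using assms(2) unfolding power2_norm_eq_inner by (simp add: field_simps)
  finally show ?thesis .
qed

lemma suesa_phi_le:
  assumes "0 < \<mu>" and "\<mu> \<le> L" and "strongly_convex \<mu> f"
  shows "suesa_phi \<mu> L f x0 k z \<le> f z"
proof (induction k)
  case 0
  then show ?case
    using assms by (simp add: quad_model_le)
next
  case (Suc k)
  have "0 \<le> \<mu> / L" "\<mu> / L \<le> 1"
    using assms by auto
  moreover have "quad_model \<mu> f (suesa_y L f x0 k) z \<le> f z"
    using assms by (simp add: quad_model_le)
  ultimately show ?case
    using Suc unfolding suesa_phi.simps suesa_alpha_def by (intro convex_bound_le) auto
qed

theorem theorem3:
  fixes f :: "real ^ 'n \<Rightarrow> real" and \<mu> L :: real and x0 :: "real ^ 'n"
  assumes "0 < \<mu>" and "\<mu> < L"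
    and "continuously_differentiable f"
    and "strongly_convex \<mu> f"
    and "smooth_with L f"
  shows "underestimate_sequence f (suesa_x L f x0) (suesa_phi \<mu> L f x0) (suesa_alpha \<mu> L)"
proof -
  let ?x = "suesa_x L f x0" and ?\<phi> = "suesa_phi \<mu> L f x0" and ?\<alpha> = "\<mu> / L"
  have \<alpha>: "0 < ?\<alpha>" "?\<alpha> < 1"
    using assms(1,2) by auto
  have min: "attains_min (?\<phi> k)" for k
    using is_parabola_suesa_phi assms(1) by (intro attains_min_parabola[of \<mu>]) auto
  have contraction:
    "f (?x (Suc k)) - min_value (?\<phi> (Suc k)) \<le> (1 - ?\<alpha>) * (f (?x k) - min_value (?\<phi> k))" for k
  proof -
    let ?G = "(norm (gradient f (?x k)))\<^sup>2"
    have Suc: "?\<phi> (Suc k) = (\<lambda>x. (1 - ?\<alpha>) * ?\<phi> k x + ?\<alpha> * quad_model \<mu> f (?x k) x)"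
      by (simp add: suesa_alpha_def suesa_y_def)
    have "(1 - ?\<alpha>) * min_value (?\<phi> k) + ?\<alpha> * (f (?x k) - ?G / (2 * \<mu>)) \<le> min_value (?\<phi> (Suc k))"
      unfolding Suc
      using \<alpha> assms(1) min min[of "Suc k", unfolded Suc]
      by (intro min_value_convex_comb_ge quad_model_ge) auto
    moreover have "f (?x (Suc k)) \<le> f (?x k) - ?G / (2 * L)"
      using gradient_step_decrease[of L f "?x k"] assms(1,2,5) by simp
    \<comment> \<open>This is where the weight \<open>\<mu> / L\<close> balances the decrease of \<open>f\<close> against the lower minimum of
      the new model.\<close>
    moreover have "?\<alpha> * (f (?x k) - ?G / (2 * \<mu>)) = ?\<alpha> * f (?x k) - ?G / (2 * L)"
      using assms(1) by (simp add: right_diff_distrib)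
    ultimately show ?thesis
      by (simp add: left_diff_distrib right_diff_distrib)
  qed
  have "?\<phi> k z \<le> f z" for k z
    using assms(1,2,4) by (intro suesa_phi_le) auto
  then show ?thesis
    unfolding underestimate_sequence_def suesa_alpha_def using \<alpha> min contraction by blast
qed

end
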